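(* Let $Q_5$ be the dihedral quandle of order $5$. The nonzero idempotents of the integral quandle ring $\mathbb{Z}[Q_5]$ are exactly the trivial idempotents; that is, for nonzero $a\in\mathbb{Z}[Q_5]$ one has $a\cdot a=a$ if and only if $a=x_i$ for some $i\in\{0,1,2,3,4\}$, where $x_0,\dots,x_4$ are the elements of $Q_5$.
   Context: The dihedral quandle $Q_n$ is the set $\{x_0,\dots,x_{n-1}\}$, with indices in $\mathbb{Z}/n\mathbb{Z}$, with operation $x_i*x_j=x_{2j-i}$ (index mod $n$). For a quandle $X$, the quandle ring $\mathbb{Z}[X]$ is the free abelian group with basis $X$, with the (in general nonassociative) multiplication extended bilinearly from the quandle operation: $\left(\sum_i r_i a_i\right)\cdot\left(\sum_j s_j a_j\right)=\sum_{i,j} r_i s_j (a_i*a_j)$. An idempotent is an element $a$ with $a\cdot a=a$. Since $x*x=x$ for every $x\in X$, each basis element $x\in X$ is an idempotent of $\mathbb{Z}[X]$; these are called the trivial idempotents. *)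

theory Defs
  imports "HOL-Library.Poly_Mapping"
begin

locale quandle =
  fixes X :: "'a set" and op :: "'a \<Rightarrow> 'a \<Rightarrow> 'a"
  assumes closed: "x \<in> X \<Longrightarrow> y \<in> X \<Longrightarrow> op x y \<in> X"
    and idem: "x \<in> X \<Longrightarrow> op x x = x"
    and right_bij: "y \<in> X \<Longrightarrow> bij_betw (\<lambda>x. op x y) X X"
    and right_distrib: "x \<in> X \<Longrightarrow> y \<in> X \<Longrightarrow> z \<in> X \<Longrightarrow>
      op (op x y) z = op (op x z) (op y z)"

text \<open>The element \<open>x\<^sub>i\<close> of the dihedral quandle is represented by the residue \<open>i\<close>
  in \<open>{0..<n}\<close>.\<close>

definition dihedral_quandle :: "nat \<Rightarrow> int set" where
  "dihedral_quandle n = {0..<int n}"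

definition dihedral_op :: "nat \<Rightarrow> int \<Rightarrow> int \<Rightarrow> int" where
  "dihedral_op n i j = (2 * j - i) mod int n"

lemma quandle_dihedral:
  assumes "n > 0"
  shows "quandle (dihedral_quandle n) (dihedral_op n)"
proof
  fix y :: int
  have inv: "dihedral_op n (dihedral_op n x y) y = x" if "x \<in> dihedral_quandle n" for x
    using that by (simp add: dihedral_op_def dihedral_quandle_def mod_simps)
  show "bij_betw (\<lambda>x. dihedral_op n x y) (dihedral_quandle n) (dihedral_quandle n)"
    using assms inv
    by (intro bij_betw_byWitness[where f' = "\<lambda>x. dihedral_op n x y"])
       (auto simp: dihedral_op_def dihedral_quandle_def)
  fix x z :: int
  have "(2 * ((2 * z - y) mod int n) - (2 * z - x)) mod int n =
    (2 * (2 * z - y) - (2 * z - x)) mod int n"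
    by (metis mod_diff_left_eq mod_mult_right_eq)
  then show "dihedral_op n (dihedral_op n x y) z =
    dihedral_op n (dihedral_op n x z) (dihedral_op n y z)"
    by (simp add: dihedral_op_def mod_simps algebra_simps)
qed (use assms in \<open>auto simp: dihedral_op_def dihedral_quandle_def\<close>)

text \<open>Elements of \<open>\<int>[X]\<close> are the finitely supported integer functions with support in \<open>X\<close>.
  The multiplication that \<open>Poly_Mapping\<close> puts on this type (convolution with respect to
  \<open>+\<close> on the index type) is not the quandle ring multiplication and is not used; only the additive
  structure is.\<close>

definition quandle_ring :: "'a set \<Rightarrow> ('a \<Rightarrow>\<^sub>0 int) set" where
  "quandle_ring X = {a. Poly_Mapping.keys a \<subseteq> X}"

definition quandle_mult ::
  "('a \<Rightarrow> 'a \<Rightarrow> 'a) \<Rightarrow> ('a \<Rightarrow>\<^sub>0 int) \<Rightarrow> ('a \<Rightarrow>\<^sub>0 int) \<Rightarrow> ('a \<Rightarrow>\<^sub>0 int)" where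
  "quandle_mult op a b =
    (\<Sum>x\<in>Poly_Mapping.keys a. \<Sum>y\<in>Poly_Mapping.keys b. Poly_Mapping.single (op x y) (Poly_Mapping.lookup a x * Poly_Mapping.lookup b y))"

definition basis_elem :: "'a \<Rightarrow> ('a \<Rightarrow>\<^sub>0 int)" where
  "basis_elem x = Poly_Mapping.single x 1"

definition is_idempotent :: "('a \<Rightarrow> 'a \<Rightarrow> 'a) \<Rightarrow> ('a \<Rightarrow>\<^sub>0 int) \<Rightarrow> bool" where
  "is_idempotent op a \<longleftrightarrow> quandle_mult op a a = a"

lemma quandle_mult_closed:
  assumes "quandle X op" "a \<in> quandle_ring X" "b \<in> quandle_ring X"
  shows "quandle_mult op a b \<in> quandle_ring X"
proof -
  interpret quandle X op by fact
  have sum_in: "sum f A \<in> quandle_ring X" if "\<And>x. x \<in> A \<Longrightarrow> f x \<in> quandle_ring X"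
    for f :: "'a \<Rightarrow> 'a \<Rightarrow>\<^sub>0 int" and A
    using that Poly_Mapping.keys_sum[of f A] by (fastforce simp: quandle_ring_def)
  have "op x y \<in> X" if "x \<in> Poly_Mapping.keys a" "y \<in> Poly_Mapping.keys b" for x y
    using assms that closed by (auto simp: quandle_ring_def)
  then show ?thesis
    unfolding quandle_mult_def by (intro sum_in) (auto simp: quandle_ring_def)
qed

lemma quandle_mult_basis_elem [simp]:
  "quandle_mult op (basis_elem x) (basis_elem y) = basis_elem (op x y)"
  by (simp add: quandle_mult_def basis_elem_def)

lemma quandle_mult_eq_sum:
  assumes "finite A" "Poly_Mapping.keys a \<subseteq> A" "finite B" "Poly_Mapping.keys b \<subseteq> B"
  shows "quandle_mult op a b =
    (\<Sum>x\<in>A. \<Sum>y\<in>B. Poly_Mapping.single (op x y) (Poly_Mapping.lookup a x * Poly_Mapping.lookup b y))"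
proof -
  have "(\<Sum>y\<in>B. Poly_Mapping.single (op x y) (Poly_Mapping.lookup a x * Poly_Mapping.lookup b y)) =
    (\<Sum>y\<in>Poly_Mapping.keys b. Poly_Mapping.single (op x y) (Poly_Mapping.lookup a x * Poly_Mapping.lookup b y))" for x
    using assms by (intro sum.mono_neutral_right) (auto simp: in_keys_iff)
  then show ?thesis
    unfolding quandle_mult_def using assms
    by (simp, intro sum.mono_neutral_left) (auto simp: in_keys_iff)
qed

lemma quandle_mult_add_left:
  "quandle_mult op (a + b) c = quandle_mult op a c + quandle_mult op b c"
proof -
  let ?A = "Poly_Mapping.keys a \<union> Poly_Mapping.keys b"
  have "Poly_Mapping.keys (a + b) \<subseteq> ?A" by (rule Poly_Mapping.keys_add)
  then show ?thesis
    by (simp add: quandle_mult_eq_sum[of ?A _ "Poly_Mapping.keys c"] lookup_add distrib_right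
        single_add sum.distrib)
qed

lemma quandle_mult_add_right:
  "quandle_mult op a (b + c) = quandle_mult op a b + quandle_mult op a c"
proof -
  let ?A = "Poly_Mapping.keys b \<union> Poly_Mapping.keys c"
  have "Poly_Mapping.keys (b + c) \<subseteq> ?A" by (rule Poly_Mapping.keys_add)
  then show ?thesis
    by (simp add: quandle_mult_eq_sum[of "Poly_Mapping.keys a" _ ?A] lookup_add distrib_left
        single_add sum.distrib)
qed

end

theory Submission
  imports Defs
begin

text \<open>
  Let \<open>\<omega>\<close> be a primitive fifth root of unity and \<open>A\<^sub>t = (\<Sum>i. a\<^sub>i \<omega>\<^bsup>t i\<^esup>)\<close>. Since
  \<open>x\<^sub>i * x\<^sub>j = x\<^bsub>2 j - i\<^esub>\<close>, the equation \<open>a \<cdot> a = a\<close> reads \<open>A\<^sub>t = A\<^bsub>2 t\<^esub> A\<^bsub>-t\<^esub>\<close>, and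
  \<open>A\<^bsub>-t\<^esub>\<close> is the complex conjugate of \<open>A\<^sub>t\<close>. Hence the squared moduli satisfy
  \<open>\<bar>A\<^sub>t\<bar>\<^sup>2 = \<bar>A\<^bsub>2 t\<^esub>\<bar>\<^sup>2 \<bar>A\<^sub>t\<bar>\<^sup>2\<close>, which says that \<open>\<bar>A\<^sub>0\<bar>\<^sup>2\<close> is \<open>0\<close> or \<open>1\<close> and that the other four
  are all \<open>0\<close> or all \<open>1\<close>.

  The squared moduli are the Fourier coefficients of the autocorrelation
  \<open>r\<^sub>d = (\<Sum>i. a\<^sub>i a\<^bsub>i + d\<^esub>)\<close>, so the whole argument takes place among integers. Because \<open>2\<close>
  generates the units modulo \<open>5\<close>, the nontrivial moduli agree, that is \<open>r\<^sub>1 = r\<^sub>2 = r\<close>. Then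
  \<open>\<bar>A\<^sub>0\<bar>\<^sup>2 = r\<^sub>0 + 4 r\<close> and \<open>\<bar>A\<^sub>1\<bar>\<^sup>2 = r\<^sub>0 - r\<close> are both \<open>0\<close> or \<open>1\<close>; they differ by \<open>5 r\<close>, so
  \<open>r = 0\<close> and \<open>r\<^sub>0 = (\<Sum>i. a\<^sub>i\<^sup>2)\<close> is at most \<open>1\<close>. A nonzero integer vector with this property is
  \<open>x\<^sub>i\<close> or \<open>- x\<^sub>i\<close>, and \<open>- x\<^sub>i\<close> squares to \<open>x\<^sub>i\<close>.

  The identity for the moduli is \<open>autocorrelation_dihedral_square\<close>, and the bound on \<open>r\<^sub>0\<close> is
  \<open>dihedral_5_idempotent_sum_of_squares_le_1\<close>.
\<close>

lemma lookup_quandle_mult_dihedral: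
  assumes "n > 0"
    and a: "a \<in> quandle_ring (dihedral_quandle n)"
    and b: "b \<in> quandle_ring (dihedral_quandle n)"
    and k: "k \<in> dihedral_quandle n"
  shows "Poly_Mapping.lookup (quandle_mult (dihedral_op n) a b) k =
    (\<Sum>j\<in>{0..<int n}. Poly_Mapping.lookup a ((2 * j - k) mod int n) * Poly_Mapping.lookup b j)"
proof -
  let ?A = "{0..<int n}"
  \<comment> \<open>Right translations of the dihedral quandle are involutions.\<close>
  have solve: "dihedral_op n i j = k \<longleftrightarrow> i = (2 * j - k) mod int n" if "i \<in> ?A" for i j
    using that k by (auto simp: dihedral_op_def dihedral_quandle_def mod_simps)
  have "Poly_Mapping.lookup (quandle_mult (dihedral_op n) a b) k =
      (\<Sum>j\<in>?A. \<Sum>i\<in>?A. Poly_Mapping.lookup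
        (Poly_Mapping.single (dihedral_op n i j) (Poly_Mapping.lookup a i * Poly_Mapping.lookup b j)) k)"
    using a b
    by (subst quandle_mult_eq_sum[of ?A _ ?A])
       (auto simp: quandle_ring_def dihedral_quandle_def lookup_sum intro: sum.swap)
  also have "\<dots> = (\<Sum>j\<in>?A. \<Sum>i\<in>?A. if i = (2 * j - k) mod int n
      then Poly_Mapping.lookup a i * Poly_Mapping.lookup b j else 0)"
    using solve by (intro sum.cong refl) (auto simp: lookup_single when_def)
  also have "\<dots> = (\<Sum>j\<in>?A. Poly_Mapping.lookup a ((2 * j - k) mod int n) * Poly_Mapping.lookup b j)"
    using \<open>n > 0\<close> by (intro sum.cong refl) (simp add: sum.delta)
  finally show ?thesis .
qed

definition autocorrelation :: "nat \<Rightarrow> (int \<Rightarrow> int) \<Rightarrow> int \<Rightarrow> int" where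
  "autocorrelation n c d = (\<Sum>i\<in>{0..<int n}. c i * c ((i + d) mod int n))"

lemma residues_mod_5: "{0..<5::int} = {0, 1, 2, 3, 4}"
  by auto

text \<open>The Fourier identity \<open>\<bar>A\<^sub>t\<bar>\<^sup>2 = \<bar>A\<^bsub>2 t\<^esub>\<bar>\<^sup>2 \<bar>A\<^sub>t\<bar>\<^sup>2\<close> in terms of coefficients: the
  autocorrelation of a square is the cyclic convolution of \<open>r\<close> with \<open>r\<close> transported along
  doubling. Doubling interchanges the classes \<open>\<plusminus>1\<close> and \<open>\<plusminus>2\<close> modulo \<open>5\<close>, which is why the
  values at \<open>d = 1\<close> and \<open>d = 2\<close> coincide.\<close>

lemma autocorrelation_dihedral_square:
  fixes c c' :: "int \<Rightarrow> int"
  assumes c': "\<And>k. k \<in> {0..<5} \<Longrightarrow> c' k = (\<Sum>j\<in>{0..<5}. c ((2 * j - k) mod 5) * c j)"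
  defines "r \<equiv> autocorrelation 5 c"
  shows "autocorrelation 5 c' 0 = (r 0)\<^sup>2 + 4 * r 1 * r 2"
    and "autocorrelation 5 c' 1 = r 0 * (r 1 + r 2) + (r 1)\<^sup>2 + r 1 * r 2 + (r 2)\<^sup>2"
    and "autocorrelation 5 c' 2 = r 0 * (r 1 + r 2) + (r 1)\<^sup>2 + r 1 * r 2 + (r 2)\<^sup>2"
proof -
  have vals:
    "c' 0 = c 0 * c 0 + c 2 * c 1 + c 4 * c 2 + c 1 * c 3 + c 3 * c 4"
    "c' 1 = c 4 * c 0 + c 1 * c 1 + c 3 * c 2 + c 0 * c 3 + c 2 * c 4"
    "c' 2 = c 3 * c 0 + c 0 * c 1 + c 2 * c 2 + c 4 * c 3 + c 1 * c 4"
    "c' 3 = c 2 * c 0 + c 4 * c 1 + c 1 * c 2 + c 3 * c 3 + c 0 * c 4"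
    "c' 4 = c 1 * c 0 + c 3 * c 1 + c 0 * c 2 + c 2 * c 3 + c 4 * c 4"
    by (simp_all add: c' residues_mod_5)
  show "autocorrelation 5 c' 0 = (r 0)\<^sup>2 + 4 * r 1 * r 2"
    "autocorrelation 5 c' 1 = r 0 * (r 1 + r 2) + (r 1)\<^sup>2 + r 1 * r 2 + (r 2)\<^sup>2"
    "autocorrelation 5 c' 2 = r 0 * (r 1 + r 2) + (r 1)\<^sup>2 + r 1 * r 2 + (r 2)\<^sup>2"
    by (simp_all add: r_def autocorrelation_def residues_mod_5 vals power2_eq_square algebra_simps)
qed

lemma int_square_eq_self:
  fixes x :: int
  assumes "x = x\<^sup>2"
  shows "x = 0 \<or> x = 1"
  using assms by (simp add: power2_eq_square)

lemma sum_of_squares_le_1_imp_other_zero: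
  fixes c :: "'a \<Rightarrow> int"
  assumes "finite A" and le: "(\<Sum>i\<in>A. (c i)\<^sup>2) \<le> 1"
    and i: "i \<in> A" "c i \<noteq> 0" and j: "j \<in> A - {i}"
  shows "c j = 0"
proof -
  have "(\<Sum>j\<in>A. (c j)\<^sup>2) = (c i)\<^sup>2 + (\<Sum>j\<in>A - {i}. (c j)\<^sup>2)"
    using assms by (intro sum.remove)
  moreover have "(\<Sum>j\<in>A - {i}. (c j)\<^sup>2) \<ge> 0"
    by (intro sum_nonneg) simp
  moreover have "(c i)\<^sup>2 > 0"
    using i by simp
  ultimately have "(\<Sum>j\<in>A - {i}. (c j)\<^sup>2) = 0"
    using le by linarith
  then show ?thesis
    using j \<open>finite A\<close> by (auto simp: sum_nonneg_eq_0_iff)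
qed

lemma dihedral_5_idempotent_sum_of_squares_le_1:
  assumes a: "a \<in> quandle_ring (dihedral_quandle 5)"
    and idem: "is_idempotent (dihedral_op 5) a"
  shows "(\<Sum>i\<in>{0..<5}. (Poly_Mapping.lookup a i)\<^sup>2) \<le> 1"
proof -
  define c where "c = Poly_Mapping.lookup a"
  define r where "r = autocorrelation 5 c"
  have "c k = (\<Sum>j\<in>{0..<5}. c ((2 * j - k) mod 5) * c j)" if "k \<in> {0..<5}" for k
    using lookup_quandle_mult_dihedral[OF _ a a, of k] that idem
    by (simp add: c_def is_idempotent_def dihedral_quandle_def)
  from autocorrelation_dihedral_square[of c c, OF this]
  have r0: "r 0 = (r 0)\<^sup>2 + 4 * r 1 * r 2"
    and r1: "r 1 = r 0 * (r 1 + r 2) + (r 1)\<^sup>2 + r 1 * r 2 + (r 2)\<^sup>2"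
    and "r 2 = r 0 * (r 1 + r 2) + (r 1)\<^sup>2 + r 1 * r 2 + (r 2)\<^sup>2"
    unfolding r_def by blast+
  then have r2: "r 2 = r 1"
    by linarith
  \<comment> \<open>These are the two distinct Fourier coefficients of \<open>r\<close>, at \<open>t = 0\<close> and at \<open>t \<noteq> 0\<close>.\<close>
  have "r 0 + 4 * r 1 = (r 0 + 4 * r 1)\<^sup>2" and "r 0 - r 1 = (r 0 - r 1)\<^sup>2"
    using r0 r1 unfolding r2 by algebra+
  then have "r 0 + 4 * r 1 = 0 \<or> r 0 + 4 * r 1 = 1" and "r 0 - r 1 = 0 \<or> r 0 - r 1 = 1"
    using int_square_eq_self by blast+
  then have "r 0 \<le> 1"
    by presburger
  moreover have "r 0 = (\<Sum>i\<in>{0..<5}. (c i)\<^sup>2)"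
    by (simp add: r_def autocorrelation_def power2_eq_square)
  ultimately show ?thesis
    by (simp add: c_def)
qed

theorem theorem3p1:
  fixes a :: "int \<Rightarrow>\<^sub>0 int"
  assumes "a \<in> quandle_ring (dihedral_quandle 5)"
    and "a \<noteq> 0"
  shows "is_idempotent (dihedral_op 5) a \<longleftrightarrow> (\<exists>i\<in>{0, 1, 2, 3, 4}. a = basis_elem i)"
proof
  interpret quandle "dihedral_quandle 5" "dihedral_op 5"
    by (rule quandle_dihedral) simp
  have residues: "dihedral_quandle 5 = {0, 1, 2, 3, 4}"
    by (simp add: dihedral_quandle_def residues_mod_5)
  show "is_idempotent (dihedral_op 5) a" if trivial: "\<exists>i\<in>{0, 1, 2, 3, 4}. a = basis_elem i"
  proof -
    obtain i where "i \<in> dihedral_quandle 5" "a = basis_elem i"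
      using trivial unfolding residues by blast
    then show ?thesis
      by (simp add: is_idempotent_def idem)
  qed
  assume idempotent: "is_idempotent (dihedral_op 5) a"
  let ?c = "Poly_Mapping.lookup a"
  have outside: "?c j = 0" if "j \<notin> {0..<5}" for j
    using assms(1) that by (auto simp: quandle_ring_def dihedral_quandle_def in_keys_iff)
  obtain i where "?c i \<noteq> 0"
    using \<open>a \<noteq> 0\<close> by (metis poly_mapping_eqI lookup_zero)
  with outside have i: "i \<in> {0..<5}" "?c i \<noteq> 0"
    by blast+
  note others_zero = sum_of_squares_le_1_imp_other_zero[of "{0..<5}" ?c,
      OF _ dihedral_5_idempotent_sum_of_squares_le_1[OF assms(1) idempotent] i]
  have a_eq: "a = Poly_Mapping.single i (?c i)"
    using others_zero outside
    by (intro poly_mapping_eqI) (auto simp: lookup_single when_def)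
  have "dihedral_op 5 i i = i"
    using i by (intro idem) (simp add: dihedral_quandle_def)
  then have "quandle_mult (dihedral_op 5) a a = Poly_Mapping.single i (?c i * ?c i)"
    using i by (subst (1 2) a_eq) (simp add: quandle_mult_def)
  then have "?c i = ?c i * ?c i"
    using idempotent by (metis is_idempotent_def lookup_single_eq)
  then have "?c i = 1"
    using i by simp
  then show "\<exists>i\<in>{0, 1, 2, 3, 4}. a = basis_elem i"
    using i a_eq by (auto simp: basis_elem_def residues_mod_5)
qed

end
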